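(* Let $K\subset\mathbb{C}^n$ be a compact set. Then there exists a Borel probability measure $\nu$ on $K$ such that $(K,\nu)$ satisfies a Bernstein-Markov property.
   Context: $K$ is understood to be nonempty. $(K,\nu)$ satisfies a Bernstein-Markov property if there are constants $M_k$ ($k=1,2,\dots$) with $\limsup_{k\to\infty}M_k^{1/k}=1$ such that, for every $k$ and every holomorphic polynomial $p_k$ on $\mathbb{C}^n$ of degree at most $k$, $$\sup_{z\in K}|p_k(z)|\le M_k\|p_k\|_{L^2(\nu)}.$$ *)

theory Defs
  imports "HOL-Probability.Probability"
begin

definition multi_indices :: "nat \<Rightarrow> ('n::finite \<Rightarrow> nat) set" where
  "multi_indices k = {\<alpha>. (\<Sum>i\<in>UNIV. \<alpha> i) \<le> k}"

(* Finiteness matters: otherwise the sum in holo_polys below would silently be 0. *)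
lemma finite_multi_indices: "finite (multi_indices k :: ('n::finite \<Rightarrow> nat) set)"
proof (rule finite_subset)
  show "(multi_indices k :: ('n \<Rightarrow> nat) set) \<subseteq> Pi\<^sub>E UNIV (\<lambda>_. {..k})"
  proof
    fix \<alpha> :: "'n \<Rightarrow> nat" assume "\<alpha> \<in> multi_indices k"
    then have "(\<Sum>i\<in>UNIV. \<alpha> i) \<le> k" by (simp add: multi_indices_def)
    moreover have "\<alpha> i \<le> (\<Sum>i\<in>UNIV. \<alpha> i)" for i by (rule member_le_sum) auto
    ultimately have "\<alpha> i \<le> k" for i by (meson le_trans)
    then show "\<alpha> \<in> Pi\<^sub>E UNIV (\<lambda>_. {..k})" by auto
  qed
  show "finite (Pi\<^sub>E UNIV (\<lambda>_. {..k}) :: ('n \<Rightarrow> nat) set)"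
    by (rule finite_PiE) auto
qed

(* Holomorphic polynomials on C^n of total degree at most k, as functions. *)
definition holo_polys :: "nat \<Rightarrow> (complex ^ 'n::finite \<Rightarrow> complex) set" where
  "holo_polys k =
     {p. \<exists>c :: ('n \<Rightarrow> nat) \<Rightarrow> complex.
           p = (\<lambda>z. \<Sum>\<alpha>\<in>multi_indices k. c \<alpha> * (\<Prod>i\<in>UNIV. (z $ i) ^ \<alpha> i))}"

definition L2_norm_of :: "'a measure \<Rightarrow> ('a \<Rightarrow> complex) \<Rightarrow> real" where
  "L2_norm_of \<nu> f = sqrt (\<integral>z. (norm (f z))\<^sup>2 \<partial>\<nu>)"

(* The trace on K of the Borel sigma-algebra of the ambient space is the Borel
   sigma-algebra of K; in particular the underlying space of \<nu> is K itself. *)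
definition borel_prob_measure_on :: "'a::topological_space set \<Rightarrow> 'a measure \<Rightarrow> bool" where
  "borel_prob_measure_on K \<nu> \<longleftrightarrow>
     prob_space \<nu> \<and> sets \<nu> = sets (restrict_space borel K)"

(* Intended for K compact and nonempty and \<nu> a finite Borel measure on K, so that the real
   supremum and the integral in the L2 norm are those of a bounded continuous function.
   Then p = 1 in the inequality forces M k > 0, so the k-th root needs no side condition;
   the index k = 0 does not affect the limsup. *)
definition Bernstein_Markov :: "(complex ^ 'n::finite) set \<Rightarrow> (complex ^ 'n) measure \<Rightarrow> bool" where
  "Bernstein_Markov K \<nu> \<longleftrightarrow>
     (\<exists>M :: nat \<Rightarrow> real.
        limsup (\<lambda>k. ereal (root k (M k))) = 1 \<and>
        (\<forall>k\<ge>1. \<forall>p\<in>holo_polys k.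
           (SUP z\<in>K. norm (p z)) \<le> M k * L2_norm_of \<nu> p))"

end

theory Submission
  imports "Jordan_Normal_Form.Determinant" Defs "HOL-Real_Asymp.Real_Asymp"
begin

text \<open>For each degree \<open>k\<close> choose almost Fekete nodes in \<open>K\<close>: points that maximise, up to a factor 2,
  a nonvanishing generalised Vandermonde determinant of maximal size. Lagrange interpolation at
  them bounds the supremum norm of a polynomial of degree at most \<open>k\<close> by twice the sum of its
  absolute values at these nodes, of which there are at most \<open>(k + 1)\<^sup>n\<close>. The measure \<open>\<nu>\<close> is the
  sum of point masses of polynomially decaying weight at all nodes of all degrees, so the
  constants \<open>M\<^sub>k\<close> grow only polynomially in \<open>k\<close>.\<close>

section \<open>Determinants of interpolation matrices\<close>

text \<open>Nodes index the columns, so moving one node changes a single column; column expansion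
  and Cramer's rule then apply directly.\<close>

definition interp_mat :: "nat \<Rightarrow> (nat \<Rightarrow> 'a \<Rightarrow> 'b::comm_ring_1) \<Rightarrow> (nat \<Rightarrow> 'a) \<Rightarrow> 'b mat" where
  "interp_mat r g x = Matrix.mat r r (\<lambda>(i, j). g i (x j))"

lemma interp_mat_carrier [simp]: "interp_mat r g x \<in> carrier_mat r r"
  by (simp add: interp_mat_def)

lemma interp_mat_index [simp]: "i < r \<Longrightarrow> j < r \<Longrightarrow> interp_mat r g x $$ (i, j) = g i (x j)"
  by (simp add: interp_mat_def)

lemma interp_mat_cong:
  assumes "\<And>i. i < r \<Longrightarrow> g i = g' i" "\<And>j. j < r \<Longrightarrow> x j = x' j"
  shows "interp_mat r g x = interp_mat r g' x'"
  unfolding interp_mat_def by (rule cong_mat) (use assms in auto)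

text \<open>Laplace expansion along the last column, the only one containing the new node. With the
  other nodes fixed, the cofactors are constants, and the last of them is the smaller
  determinant.\<close>

lemma det_interp_mat_Suc:
  obtains C where "\<And>y. Determinant.det (interp_mat (Suc r) g (x(r := y))) =
      (\<Sum>i<r. C i * g i y) + Determinant.det (interp_mat r g x) * g r y"
proof
  fix y
  define A where "A = (\<lambda>y. interp_mat (Suc r) g (x(r := y)))"
  \<comment> \<open>Column \<open>r\<close> holds the only entries that depend on \<open>y\<close>;
    \<open>x r\<close> serves as an arbitrary reference value at which the coefficients are read
    off.\<close>
  have del: "mat_delete (A y) i r = mat_delete (A (x r)) i r" if "i < Suc r" for i
    unfolding mat_delete_def
    by (rule eq_matI) (use that in \<open>auto simp: A_def interp_mat_def\<close>)
  have cof: "cofactor (A y) i r = cofactor (A (x r)) i r" if "i < Suc r" for i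
    using del[OF that] by (simp add: cofactor_def)
  have "mat_delete (A y) r r = interp_mat r g x"
    unfolding mat_delete_def
    by (rule eq_matI) (auto simp: A_def interp_mat_def)
  then have cof_r: "cofactor (A y) r r = Determinant.det (interp_mat r g x)"
    by (simp add: cofactor_def flip: mult_2)
  have "Determinant.det (A y) = (\<Sum>i<Suc r. A y $$ (i, r) * cofactor (A y) i r)"
    by (rule laplace_expansion_column) (auto simp: A_def)
  also have "\<dots> = (\<Sum>i<Suc r. g i y * cofactor (A y) i r)"
    by (intro sum.cong refl) (auto simp: A_def)
  also have "\<dots> = (\<Sum>i<r. cofactor (A (x r)) i r * g i y)
      + Determinant.det (interp_mat r g x) * g r y"
    using cof cof_r by (simp add: mult.commute)
  finally show "Determinant.det (interp_mat (Suc r) g (x(r := y))) =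
      (\<Sum>i<r. cofactor (interp_mat (Suc r) g (x(r := x r))) i r * g i y)
      + Determinant.det (interp_mat r g x) * g r y"
    by (simp add: A_def)
qed

text \<open>Induction on \<open>I\<close>, bordering the current determinant by the new function and
  a further node. Either some node in \<open>K\<close> makes the bordered determinant nonzero and
  both are added, or it vanishes on all of \<open>K\<close> and its expansion expresses the new
  function through the selected ones.\<close>

lemma unisolvent_subfamily:
  fixes f :: "'i \<Rightarrow> 'a \<Rightarrow> 'b::field"
  assumes "finite I"
  shows "\<exists>r s x. r \<le> card I \<and> (\<forall>l<r. s l \<in> I) \<and> (\<forall>j<r. x j \<in> K) \<and>
    Determinant.det (interp_mat r (\<lambda>l. f (s l)) x) \<noteq> 0 \<and>
    (\<forall>i\<in>I. \<exists>c. \<forall>y\<in>K. f i y = (\<Sum>l<r. c l * f (s l) y))"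
  using assms
proof (induction I)
  case empty
  \<comment> \<open>For \<open>r = 0\<close> the determinant is that of the empty matrix, which is
    1.\<close>
  show ?case
    by (rule exI[of _ 0]) (simp add: interp_mat_def)
next
  case (insert a I)
  then obtain r s x where *: "r \<le> card I" "\<forall>l<r. s l \<in> I" "\<forall>j<r. x j \<in> K"
    "Determinant.det (interp_mat r (\<lambda>l. f (s l)) x) \<noteq> 0"
    and span: "\<forall>i\<in>I. \<exists>c. \<forall>y\<in>K. f i y = (\<Sum>l<r. c l * f (s l) y)"
    by (elim exE conjE) (rule that)
  define d where "d = Determinant.det (interp_mat r (\<lambda>l. f (s l)) x)"
  define s' where "s' = s(r := a)"
  have d': "d = Determinant.det (interp_mat r (\<lambda>l. f (s' l)) x)"
    unfolding d_def by (intro arg_cong[of _ _ Determinant.det] interp_mat_cong) (auto simp: s'_def)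
  obtain C where C: "\<And>y. Determinant.det (interp_mat (Suc r) (\<lambda>l. f (s' l)) (x(r := y))) =
      (\<Sum>l<r. C l * f (s' l) y) + d * f (s' r) y"
    using det_interp_mat_Suc[of r "\<lambda>l. f (s' l)" x] unfolding d' by metis
  show ?case
  proof (cases "\<exists>y\<in>K. Determinant.det (interp_mat (Suc r) (\<lambda>l. f (s' l)) (x(r := y))) \<noteq> 0")
    case True
    then obtain y where y: "y \<in> K"
      "Determinant.det (interp_mat (Suc r) (\<lambda>l. f (s' l)) (x(r := y))) \<noteq> 0" by blast
    have "\<exists>c. \<forall>y\<in>K. f i y = (\<Sum>l<Suc r. c l * f (s' l) y)" if "i \<in> insert a I" for i
    proof (cases "i = a")
      case True
      then show ?thesis
        by (intro exI[of _ "\<lambda>l. if l = r then 1 else 0"]) (auto simp: s'_def)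
    next
      case False
      then obtain c where "\<forall>y\<in>K. f i y = (\<Sum>l<r. c l * f (s l) y)"
        using \<open>i \<in> insert a I\<close> span by blast
      then show ?thesis
        by (intro exI[of _ "c(r := 0)"]) (auto simp: s'_def)
    qed
    moreover have "Suc r \<le> card (insert a I)" "\<forall>l<Suc r. s' l \<in> insert a I"
      "\<forall>j<Suc r. (x(r := y)) j \<in> K"
      using * y(1) insert.hyps by (auto simp: s'_def less_Suc_eq)
    ultimately show ?thesis
      using y(2) by blast
  next
    case False
    have "f a y = (\<Sum>l<r. (- C l / d) * f (s l) y)" if "y \<in> K" for y
    proof -
      have "d * f a y = - (\<Sum>l<r. C l * f (s l) y)"
        using False C[of y] that by (simp add: s'_def add_eq_0_iff)
      then have "f a y = - (\<Sum>l<r. C l * f (s l) y) / d"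
        using *(4) by (simp add: d_def field_simps)
      then show ?thesis
        by (simp add: sum_divide_distrib sum_negf)
    qed
    then have "\<exists>c. \<forall>y\<in>K. f a y = (\<Sum>l<r. c l * f (s l) y)"
      by (intro exI[of _ "\<lambda>l. - C l / d"]) blast
    with span have "\<forall>i\<in>insert a I. \<exists>c. \<forall>y\<in>K. f i y = (\<Sum>l<r. c l * f (s l) y)"
      by simp
    moreover have "r \<le> card (insert a I)" "\<forall>l<r. s l \<in> insert a I"
      using * insert.hyps by auto
    ultimately show ?thesis
      using *(3,4) by blast
  qed
qed

section \<open>Almost extremal nodes with bounded interpolation weights\<close>

text \<open>Leibniz formula: \<open>fact n\<close> products of \<open>n\<close> entries each. The
  crude bound makes the supremum of the determinants over all choices of nodes finite.\<close>

lemma norm_det_le: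
  fixes A :: "'a::{real_normed_field} mat"
  assumes A: "A \<in> carrier_mat n n" and B: "\<And>i j. i < n \<Longrightarrow> j < n \<Longrightarrow> norm (A $$ (i, j)) \<le> B"
  shows "norm (Determinant.det A) \<le> fact n * B ^ n"
proof -
  have "norm (signof p * (\<Prod>i = 0..<n. A $$ (i, p i))) \<le> B ^ n" if "p permutes {0..<n}" for p
  proof -
    have "p i < n" if "i < n" for i
      using permutes_in_image[OF \<open>p permutes {0..<n}\<close>, of i] that by simp
    then have "(\<Prod>i = 0..<n. norm (A $$ (i, p i))) \<le> (\<Prod>i = 0..<n. B)"
      by (intro prod_mono) (auto intro: B)
    then show ?thesis
      by (simp add: norm_mult sign_def flip: prod_norm)
  qed
  then have "(\<Sum>p | p permutes {0..<n}. norm (signof p * (\<Prod>i = 0..<n. A $$ (i, p i))))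
      \<le> (\<Sum>p | p permutes {0..<n}. B ^ n)"
    by (intro sum_mono) auto
  also have "\<dots> = fact n * B ^ n"
    by (simp add: card_permutations[of "{0..<n}" n])
  finally show ?thesis
    unfolding det_def'[OF A] by (rule order_trans[OF norm_sum])
qed

text \<open>Cramer's rule expresses the weights as quotients of determinants whose numerators are
  again determinants of interpolation matrices, with one node replaced by \<open>y\<close>. For nodes that
  maximise the determinant up to a factor 2, these quotients are at most 2.\<close>

lemma almost_Fekete_nodes:
  fixes f :: "'i \<Rightarrow> 'a \<Rightarrow> 'b::real_normed_field"
  assumes "finite I" and bounded: "\<And>i. i \<in> I \<Longrightarrow> bounded (f i ` K)"
  obtains r x where "r \<le> card I" "\<forall>j<r. x j \<in> K"
    "\<forall>y\<in>K. \<exists>w. (\<forall>j<r. norm (w j) \<le> 2) \<and> (\<forall>i\<in>I. f i y = (\<Sum>j<r. w j * f i (x j)))"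
proof -
  obtain r s x0 where r: "r \<le> card I" and s: "\<forall>l<r. s l \<in> I" and x0: "\<forall>j<r. x0 j \<in> K"
    and nz: "Determinant.det (interp_mat r (\<lambda>l. f (s l)) x0) \<noteq> 0"
    and span: "\<forall>i\<in>I. \<exists>c. \<forall>y\<in>K. f i y = (\<Sum>l<r. c l * f (s l) y)"
    using unisolvent_subfamily[OF assms(1), of K f] by (elim exE conjE) (rule that)
  define g where "g = (\<lambda>l. f (s l))"
  define D where "D = (\<lambda>x. norm (Determinant.det (interp_mat r g x)))"
  define S where "S = D ` {x. \<forall>j<r. x j \<in> K}"
  have "bounded (\<Union>i\<in>I. f i ` K)"
    using assms by (intro bounded_UN) auto
  then obtain B where B: "\<And>i y. i \<in> I \<Longrightarrow> y \<in> K \<Longrightarrow> norm (f i y) \<le> B"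
    unfolding bounded_iff by blast
  have "D x \<le> fact r * B ^ r" if "\<forall>j<r. x j \<in> K" for x
    unfolding D_def by (rule norm_det_le) (use B s that in \<open>auto simp: g_def\<close>)
  then have bdd: "bdd_above S"
    unfolding S_def by (intro bdd_aboveI2) auto
  have x0S: "D x0 \<in> S" and "D x0 > 0"
    using x0 nz by (auto simp: S_def D_def g_def)
  then have "Sup S > 0"
    using cSup_upper[OF x0S bdd] by linarith
  \<comment> \<open>The supremum need not be attained, as the functions are merely bounded; since it
    is positive, some choice of nodes in \<open>K\<close> exceeds half of it.\<close>
  then have "Sup S / 2 < Sup S" by simp
  then obtain d where "d \<in> S" "Sup S / 2 < d"
    by (rule less_cSupE) (use x0S in auto)
  then obtain x where xK: "\<forall>j<r. x j \<in> K" and x: "Sup S / 2 < D x"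
    by (auto simp: S_def)
  have D_le: "D x' \<le> 2 * D x" if "\<forall>j<r. x' j \<in> K" for x'
  proof -
    have "D x' \<in> S" using that by (auto simp: S_def)
    then show ?thesis using cSup_upper[OF _ bdd] x by fastforce
  qed
  define A where "A = interp_mat r g x"
  have A: "A \<in> carrier_mat r r" by (simp add: A_def)
  have nzA: "Determinant.det A \<noteq> 0"
    using x \<open>Sup S > 0\<close> by (auto simp: D_def A_def)
  have "\<exists>w. (\<forall>j<r. norm (w j) \<le> 2) \<and> (\<forall>i\<in>I. f i y = (\<Sum>j<r. w j * f i (x j)))"
    if y: "y \<in> K" for y
  proof -
    \<comment> \<open>The weights solve the linear system \<open>A *\<^sub>v v = b\<close>, whose
      equation \<open>l\<close> says that they reproduce \<open>g l\<close> at \<open>y\<close>;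
      \<open>A'\<close> is the inverse of \<open>A\<close>, built from the adjugate.\<close>
    define b where "b = Matrix.vec r (\<lambda>l. g l y)"
    have b: "b \<in> carrier_vec r" by (simp add: b_def)
    define A' where "A' = (1 / Determinant.det A) \<cdot>\<^sub>m adj_mat A"
    have A': "A' \<in> carrier_mat r r"
      using adj_mat(1)[OF A] by (simp add: A'_def)
    have AA': "A * A' = 1\<^sub>m r"
      unfolding A'_def mult_smult_distrib[OF A adj_mat(1)[OF A]] adj_mat(2)[OF A]
      by (rule eq_matI) (use nzA in auto)
    define v where "v = A' *\<^sub>v b"
    have v: "v \<in> carrier_vec r"
      using A' b by (simp add: v_def)
    have Av: "A *\<^sub>v v = b"
      using assoc_mult_mat_vec[OF A A' b] AA' b by (simp add: v_def)
    have "norm (vec_index v j) \<le> 2" if j: "j < r" for j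
    proof -
      have "replace_col A b j = interp_mat r g (x(j := y))"
        unfolding replace_col_def
        by (rule eq_matI) (auto simp: A_def b_def interp_mat_def)
      then have "norm (vec_index v j) * D x = D (x(j := y))"
        using cramer_lemma_mat[OF A v j] Av by (simp add: D_def A_def norm_mult)
      also have "\<dots> \<le> 2 * D x"
        using xK y by (intro D_le) auto
      finally show ?thesis
        using x \<open>Sup S > 0\<close> by simp
    qed
    \<comment> \<open>The system controls only the selected functions. Each \<open>f i\<close> is a
      fixed combination of these on \<open>K\<close>, which contains \<open>y\<close> and all nodes,
      so the same weights reproduce it.\<close>
    moreover have "f i y = (\<Sum>j<r. vec_index v j * f i (x j))" if i: "i \<in> I" for i
    proof -
      have g: "g l y = (\<Sum>j<r. vec_index v j * g l (x j))" if l: "l < r" for l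
      proof -
        have "g l y = vec_index (A *\<^sub>v v) l"
          using Av l by (simp add: b_def)
        also have "\<dots> = (\<Sum>j<r. vec_index v j * g l (x j))"
          using l v by (auto simp: A_def interp_mat_def scalar_prod_def lessThan_atLeast0
              mult.commute intro!: sum.cong)
        finally show ?thesis .
      qed
      obtain c where c: "\<And>y. y \<in> K \<Longrightarrow> f i y = (\<Sum>l<r. c l * g l y)"
        using span i unfolding g_def by blast
      have "f i y = (\<Sum>l<r. \<Sum>j<r. c l * (vec_index v j * g l (x j)))"
        using c[OF y] g by (simp add: sum_distrib_left)
      also have "\<dots> = (\<Sum>j<r. vec_index v j * (\<Sum>l<r. c l * g l (x j)))"
        by (subst sum.swap) (simp add: sum_distrib_left mult_ac)
      also have "\<dots> = (\<Sum>j<r. vec_index v j * f i (x j))"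
        using c xK by simp
      finally show ?thesis .
    qed
    ultimately show ?thesis by blast
  qed
  with r xK that show thesis by blast
qed

section \<open>Norming nodes for polynomials of bounded degree\<close>

lemma card_multi_indices_le:
  "card (multi_indices k :: ('n::finite \<Rightarrow> nat) set) \<le> (k + 1) ^ CARD('n)"
proof -
  have "(multi_indices k :: ('n \<Rightarrow> nat) set) \<subseteq> Pi\<^sub>E UNIV (\<lambda>_. {..k})"
  proof
    fix \<alpha> :: "'n \<Rightarrow> nat" assume "\<alpha> \<in> multi_indices k"
    then have "\<alpha> i \<le> k" for i
      using member_le_sum[of i UNIV \<alpha>] by (simp add: multi_indices_def)
    then show "\<alpha> \<in> Pi\<^sub>E UNIV (\<lambda>_. {..k})" by auto
  qed
  then have "card (multi_indices k :: ('n \<Rightarrow> nat) set) \<le> card (Pi\<^sub>E (UNIV :: 'n set) (\<lambda>_. {..k}))"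
    by (intro card_mono finite_PiE) auto
  then show ?thesis by (simp add: card_PiE)
qed

lemma continuous_on_holo_poly:
  assumes "p \<in> holo_polys k"
  shows "continuous_on S p"
  using assms unfolding holo_polys_def by (auto intro!: continuous_intros)

text \<open>Monomials are bounded on \<open>K\<close>, so they have almost Fekete nodes. The weights
  at \<open>y\<close> are the same for all monomials, hence by linearity for all polynomials, and
  their bound 2 becomes the factor of the sum.\<close>

lemma norming_nodes_holo_polys:
  fixes K :: "(complex ^ 'n::finite) set"
  assumes "compact K"
  obtains r x where "r \<le> (k + 1) ^ CARD('n)" "\<And>j. j < r \<Longrightarrow> x j \<in> K"
    "\<And>p y. p \<in> holo_polys k \<Longrightarrow> y \<in> K \<Longrightarrow> norm (p y) \<le> 2 * (\<Sum>j<r. norm (p (x j)))"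
proof -
  define f :: "('n \<Rightarrow> nat) \<Rightarrow> complex ^ 'n \<Rightarrow> complex"
    where "f = (\<lambda>\<alpha> z. \<Prod>i\<in>UNIV. (z $ i) ^ \<alpha> i)"
  have bounded: "bounded (f \<alpha> ` K)" for \<alpha>
    unfolding f_def
    by (intro compact_imp_bounded compact_continuous_image assms continuous_intros)
  obtain r x where r: "r \<le> card (multi_indices k :: ('n \<Rightarrow> nat) set)" and x: "\<forall>j<r. x j \<in> K"
    and w: "\<forall>y\<in>K. \<exists>w. (\<forall>j<r. norm (w j) \<le> 2) \<and>
      (\<forall>\<alpha>\<in>multi_indices k. f \<alpha> y = (\<Sum>j<r. w j * f \<alpha> (x j)))"
    by (rule almost_Fekete_nodes[where f = f, OF finite_multi_indices[of k] bounded]) (rule that)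
  have "norm (p y) \<le> 2 * (\<Sum>j<r. norm (p (x j)))" if p: "p \<in> holo_polys k" and y: "y \<in> K" for p y
  proof -
    obtain c where c: "\<And>z. p z = (\<Sum>\<alpha>\<in>multi_indices k. c \<alpha> * f \<alpha> z)"
      using p unfolding holo_polys_def f_def by blast
    obtain w where le2: "\<forall>j<r. norm (w j) \<le> 2"
      and w: "\<And>\<alpha>. \<alpha> \<in> multi_indices k \<Longrightarrow> f \<alpha> y = (\<Sum>j<r. w j * f \<alpha> (x j))"
      using w y by blast
    have "p y = (\<Sum>\<alpha>\<in>multi_indices k. \<Sum>j<r. c \<alpha> * (w j * f \<alpha> (x j)))"
      unfolding c by (intro sum.cong refl) (simp add: w sum_distrib_left)
    also have "\<dots> = (\<Sum>j<r. w j * p (x j))"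
      unfolding c by (subst sum.swap) (simp add: sum_distrib_left mult_ac)
    also have "norm \<dots> \<le> (\<Sum>j<r. norm (w j * p (x j)))"
      by (rule norm_sum)
    also have "\<dots> \<le> (\<Sum>j<r. 2 * norm (p (x j)))"
      using le2 by (intro sum_mono) (auto simp: norm_mult intro!: mult_right_mono)
    finally show ?thesis by (simp add: sum_distrib_left)
  qed
  from that[OF le_trans[OF r card_multi_indices_le] x[rule_format] this] show thesis .
qed

section \<open>Polynomially decaying weights and subexponential constants\<close>

text \<open>The weights are the telescoping differences \<open>1 / (k + 1) - 1 / (k + 2)\<close>,
  with total 1; their reciprocals grow only quadratically.\<close>

lemma ex_pmf_inverse_quadratic: "\<exists>P. \<forall>k. pmf P k = 1 / (real (k + 1) * real (k + 2))"
proof -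
  define a where "a = (\<lambda>k::nat. 1 / (real (k + 1) * real (k + 2)))"
  have "(\<lambda>k. 1 / real (k + 1) - 1 / real (Suc k + 1)) sums (1 / real (0 + 1) - 0)"
    by (rule telescope_sums') real_asymp
  also have "(\<lambda>k. 1 / real (k + 1) - 1 / real (Suc k + 1)) = a"
    by (auto simp: a_def field_simps)
  finally have sums: "a sums 1" by simp
  have nonneg: "a k \<ge> 0" for k by (simp add: a_def)
  have "(\<integral>\<^sup>+k. ennreal (a k) \<partial>count_space UNIV) = (\<Sum>k. ennreal (a k))"
    by (rule nn_integral_count_space_nat)
  also have "\<dots> = 1"
    using suminf_ennreal_eq[OF nonneg sums] by simp
  finally have "pmf (embed_pmf a) k = a k" for k
    using nonneg by (intro pmf_embed_pmf) auto
  then show ?thesis by (auto simp: a_def)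
qed

text \<open>A nonnegative integrand may be cut down to the single atom \<open>a\<close>. For squared
  absolute values this bounds a polynomial at one node by its L2 norm.\<close>

lemma pmf_le_integral:
  assumes "integrable (measure_pmf q) h" and "\<And>a. h a \<ge> 0"
  shows "pmf q a * h a \<le> (\<integral>a. h a \<partial>measure_pmf q)"
proof -
  have "pmf q a * h a = (\<integral>b. h a * indicator {a} b \<partial>measure_pmf q)"
    by (simp add: pmf.rep_eq)
  also have "\<dots> \<le> (\<integral>b. h b \<partial>measure_pmf q)"
    using assms
    by (intro integral_mono integrable_mult_right integrable_real_indicator)
      (auto simp: indicator_def less_top[symmetric])
  finally show ?thesis .
qed

lemma limsup_root_poly:
  fixes m :: nat
  shows "limsup (\<lambda>k. ereal (root k (2 * (real k + 2) ^ m))) = 1"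
proof -
  have "(\<lambda>k. (2 * (real k + 2) powr real m) powr (1 / real k)) \<longlonglongrightarrow> 1"
    by real_asymp
  moreover have "eventually (\<lambda>k. (2 * (real k + 2) powr real m) powr (1 / real k) =
      root k (2 * (real k + 2) ^ m)) sequentially"
    \<comment> \<open>At \<open>k = 0\<close> the two sides differ: the exponent
      \<open>1 / 0\<close> is 0, so the power is 1, whereas \<open>root 0\<close> is 0.\<close>
    using eventually_gt_at_top[of 0]
    by eventually_elim (simp add: powr_realpow root_powr_inverse)
  ultimately have "(\<lambda>k. root k (2 * (real k + 2) ^ m)) \<longlonglongrightarrow> 1"
    by (rule Lim_transform_eventually)
  then have "(\<lambda>k. ereal (root k (2 * (real k + 2) ^ m))) \<longlonglongrightarrow> ereal 1"
    by simp
  then show ?thesis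
    by (simp add: lim_imp_Limsup one_ereal_def)
qed

section \<open>The measure and its Bernstein-Markov inequality\<close>

theorem corollary3p5:
  fixes K :: "(complex ^ 'n::finite) set"
  assumes "compact K" and "K \<noteq> {}"
  shows "\<exists>\<nu>. borel_prob_measure_on K \<nu> \<and> Bernstein_Markov K \<nu>"
proof -
  define n where "n = CARD('n)"
  have "\<exists>r x. r \<le> (k + 1) ^ n \<and> (\<forall>j. x j \<in> K) \<and>
    (\<forall>p\<in>holo_polys k. \<forall>y\<in>K. norm (p y) \<le> 2 * (\<Sum>j<r. norm (p (x j))))" for k
  proof -
    obtain r x where r: "r \<le> (k + 1) ^ n" and x: "\<And>j. j < r \<Longrightarrow> x j \<in> K"
      and le: "\<And>p y. p \<in> holo_polys k \<Longrightarrow> y \<in> K \<Longrightarrow> norm (p y) \<le> 2 * (\<Sum>j<r. norm (p (x j)))"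
      using norming_nodes_holo_polys[OF \<open>compact K\<close>, of k] unfolding n_def by metis
    \<comment> \<open>Indices from \<open>r\<close> on are filled with a point of \<open>K\<close>,
      so that every pair of a degree and an index is sent into \<open>K\<close>.\<close>
    obtain y0 where "y0 \<in> K" using \<open>K \<noteq> {}\<close> by blast
    with r x le show ?thesis
      by (intro exI[of _ r] exI[of _ "\<lambda>j. if j < r then x j else y0"]) auto
  qed
  then obtain r x where r: "\<And>k. r k \<le> (k + 1) ^ n" and x: "\<And>k j. x k j \<in> K"
    and le: "\<And>k p y. p \<in> holo_polys k \<Longrightarrow> y \<in> K \<Longrightarrow>
      norm (p y) \<le> 2 * (\<Sum>j<r k. norm (p (x k j)))"
    by metis
  obtain P where P: "\<And>k. pmf P k = 1 / (real (k + 1) * real (k + 2))"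
    using ex_pmf_inverse_quadratic by blast
  \<comment> \<open>A random degree and an independent random index: the pushforward
    \<open>\<nu>\<close> gives the point \<open>x k j\<close> mass at least
    \<open>1 / ((k + 1) * (k + 2) * (j + 1) * (j + 2))\<close>, since coinciding nodes add
    up.\<close>
  define q where "q = pair_pmf P P"
  define X where "X = (\<lambda>(k, j). x k j)"
  define \<nu> where "\<nu> = distr (measure_pmf q) (restrict_space borel K) X"
  have X: "X \<in> measurable (measure_pmf q) (restrict_space borel K)"
    using x by (auto simp: X_def space_restrict_space)
  have "borel_prob_measure_on K \<nu>"
    unfolding borel_prob_measure_on_def \<nu>_def
    using measure_pmf.prob_space_distr[OF X] by simp
  have node_le: "norm (p (x k j)) \<le> (real k + 2) * (real j + 2) * L2_norm_of \<nu> p"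
    if p: "p \<in> holo_polys d" for p d k j
  proof -
    define J where "J = (\<integral>z. (norm (p z))\<^sup>2 \<partial>\<nu>)"
    have "continuous_on UNIV p" using p by (rule continuous_on_holo_poly)
    then have "p \<in> borel_measurable borel" by (rule borel_measurable_continuous_onI)
    then have "(\<lambda>z. (norm (p z))\<^sup>2) \<in> borel_measurable borel" by measurable
    then have "(\<lambda>z. (norm (p z))\<^sup>2) \<in> borel_measurable (restrict_space borel K)"
      by (rule measurable_restrict_space1)
    then have J: "J = (\<integral>a. (norm (p (X a)))\<^sup>2 \<partial>measure_pmf q)"
      unfolding J_def \<nu>_def by (rule integral_distr[OF X])
    have "bounded (p ` K)"
      using p by (intro compact_imp_bounded compact_continuous_image \<open>compact K\<close> continuous_on_holo_poly)
    then obtain B where B: "\<And>z. z \<in> K \<Longrightarrow> norm (p z) \<le> B"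
      unfolding bounded_iff by blast
    have "integrable (measure_pmf q) (\<lambda>a. (norm (p (X a)))\<^sup>2)"
      by (rule measure_pmf.integrable_const_bound[of _ "B\<^sup>2"])
        (use x B in \<open>auto simp: X_def intro!: power_mono\<close>)
    then have "pmf q (k, j) * (norm (p (X (k, j))))\<^sup>2 \<le> J"
      unfolding J by (rule pmf_le_integral) simp
    then have "(norm (p (x k j)))\<^sup>2 / (((real k + 1) * (real k + 2)) * ((real j + 1) * (real j + 2))) \<le> J"
      by (simp add: q_def pmf_pair P X_def add.commute)
    then have "(norm (p (x k j)))\<^sup>2 \<le>
        ((real k + 1) * (real k + 2)) * ((real j + 1) * (real j + 2)) * J"
      by (subst (asm) pos_divide_le_eq) (auto simp: mult_ac)
    \<comment> \<open>Enlarging the factors to a perfect square makes the square root below a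
      polynomial in \<open>k\<close> and \<open>j\<close>.\<close>
    also have "\<dots> \<le> ((real k + 2) * (real k + 2)) * ((real j + 2) * (real j + 2)) * J"
      by (intro mult_mono) (auto simp: J_def)
    also have "\<dots> = ((real k + 2) * (real j + 2))\<^sup>2 * J"
      by (simp add: power2_eq_square)
    finally have "norm (p (x k j)) \<le> sqrt (((real k + 2) * (real j + 2))\<^sup>2 * J)"
      by (rule real_le_rsqrt)
    then show ?thesis
      by (simp add: L2_norm_of_def J_def real_sqrt_mult)
  qed
  \<comment> \<open>The factor 2 is the bound on the weights. The exponent collects \<open>n\<close>
    from the number of nodes, \<open>n\<close> from the mass factor \<open>j + 2\<close>, and 1 from
    the mass factor \<open>k + 2\<close>.\<close>
  define M where "M = (\<lambda>k::nat. 2 * (real k + 2) ^ (2 * n + 1))"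
  have "(SUP z\<in>K. norm (p z)) \<le> M k * L2_norm_of \<nu> p" if p: "p \<in> holo_polys k" for k p
  proof (rule cSUP_least[OF \<open>K \<noteq> {}\<close>])
    fix y assume "y \<in> K"
    define L where "L = L2_norm_of \<nu> p"
    have "L \<ge> 0" by (simp add: L_def L2_norm_of_def)
    have "n > 0" by (simp add: n_def)
    have r1: "real (r k) \<le> (real k + 1) ^ n"
      using r[of k] by (metis of_nat_1 of_nat_add of_nat_le_iff of_nat_power)
    \<comment> \<open>The spare 1 is needed for \<open>j + 2 \<le> r k + 1\<close> when
      \<open>j < r k\<close>. The inequality uses \<open>n > 0\<close>; it fails for
      \<open>n = 0\<close>.\<close>
    moreover have "(real k + 1) ^ n + 1 \<le> (real k + 2) ^ n"
    proof -
      obtain m where m: "n = Suc m" using \<open>n > 0\<close> gr0_conv_Suc by blast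
      have "(real k + 1) ^ m * (real k + 1) + 1 \<le> (real k + 2) ^ m * (real k + 1) + (real k + 2) ^ m"
        by (intro add_mono mult_right_mono power_mono one_le_power) auto
      then show ?thesis by (simp add: m algebra_simps)
    qed
    ultimately have r2: "real (r k) + 1 \<le> (real k + 2) ^ n" by linarith
    have "norm (p y) \<le> 2 * (\<Sum>j<r k. norm (p (x k j)))"
      using le[OF p \<open>y \<in> K\<close>] .
    also have "\<dots> \<le> 2 * (\<Sum>j<r k. (real k + 2) * (real k + 2) ^ n * L)"
    proof (intro mult_left_mono sum_mono)
      fix j assume "j \<in> {..<r k}"
      then have "real j + 2 \<le> (real k + 2) ^ n" using r2 by simp
      then have "(real k + 2) * (real j + 2) * L \<le> (real k + 2) * (real k + 2) ^ n * L"
        using \<open>L \<ge> 0\<close> by (intro mult_right_mono mult_left_mono) auto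
      then show "norm (p (x k j)) \<le> (real k + 2) * (real k + 2) ^ n * L"
        using node_le[OF p, of k j] unfolding L_def by (rule order_trans[rotated])
    qed simp
    also have "\<dots> = 2 * (real (r k) * ((real k + 2) * (real k + 2) ^ n * L))"
      by simp
    also have "\<dots> \<le> 2 * ((real k + 2) ^ n * ((real k + 2) * (real k + 2) ^ n * L))"
      using r2 \<open>L \<ge> 0\<close> by (intro mult_left_mono mult_right_mono) auto
    also have "\<dots> = M k * L"
      by (simp add: M_def power_even_eq power2_eq_square)
    finally show "norm (p y) \<le> M k * L2_norm_of \<nu> p" by (simp add: L_def)
  qed
  moreover have "limsup (\<lambda>k. ereal (root k (M k))) = 1"
    unfolding M_def by (rule limsup_root_poly)
  ultimately have "Bernstein_Markov K \<nu>"
    unfolding Bernstein_Markov_def by blast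
  with \<open>borel_prob_measure_on K \<nu>\<close> show ?thesis by blast
qed

end
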